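(* A topological group $G$ is extremely amenable if and only if, for every finite subset $E \subseteq G$ and every finite uniform covering $\mathcal{U}$ of $G_{r}$, there exist $g \in G$ and $U \in \mathcal{U}$ such that $Eg \subseteq U$.
   Context: A topological group $G$ is extremely amenable if every continuous action of $G$ on a non-empty compact Hausdorff space admits a fixed point. A set $\mathcal{U}$ of subsets of $G$ is a uniform covering of $G_r$ ($G$ with its right uniformity) if there is a neighborhood $V$ of the neutral element such that for every $x\in G$ the set $Vx$ is contained in some member of $\mathcal{U}$. *)

theory Defs
  imports "HOL-Analysis.Analysis" "HOL-Algebra.Group_Action"
begin

text \<open>As usual in this generality, a topological group is not required to be Hausdorff.\<close>

locale topological_group = group G
  for G :: "('a, 'b) monoid_scheme" (structure) and T :: "'a topology" +
  assumes topspace_eq_carrier: "topspace T = carrier G"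
    and continuous_mult: "continuous_map (prod_topology T T) T (\<lambda>(x, y). x \<otimes> y)"
    and continuous_inv: "continuous_map T T (\<lambda>x. inv x)"

text \<open>Continuity of an action means joint continuity of \<open>G \<times> X \<rightarrow> X\<close>.\<close>

locale continuous_action = topological_group G T + group_action G "topspace X" \<phi>
  for G :: "('a, 'b) monoid_scheme" (structure) and T :: "'a topology"
    and X :: "'x topology" and \<phi> :: "'a \<Rightarrow> 'x \<Rightarrow> 'x" +
  assumes continuous_act: "continuous_map (prod_topology T X) X (\<lambda>(g, x). \<phi> g x)"

text \<open>HOL cannot quantify over all types inside a formula, so the compact spaces range over all
  topologies whose points are taken from the fixed type \<^typ>\<open>'a set set\<close>, with \<^typ>\<open>'a\<close> the type of
  group elements. This is no restriction: the closure of an orbit is an invariant compact subspace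
  with at most as many points as there are sets of subsets of \<open>G\<close>. The lemma
  \<open>extremely_amenable_fixed_point\<close> below derives the fixed point property for compact
  Hausdorff spaces over an arbitrary type.\<close>

definition extremely_amenable :: "('a, 'b) monoid_scheme \<Rightarrow> 'a topology \<Rightarrow> bool" where
  "extremely_amenable G T \<longleftrightarrow>
    (\<forall>(X :: 'a set set topology) \<phi>.
       compact_space X \<and> Hausdorff_space X \<and> topspace X \<noteq> {} \<and> continuous_action G T X \<phi> \<longrightarrow>
       (\<exists>x\<in>topspace X. \<forall>g\<in>carrier G. \<phi> g x = x))"

text \<open>Neighbourhoods need not be open.\<close>

definition right_uniform_covering ::
    "('a, 'b) monoid_scheme \<Rightarrow> 'a topology \<Rightarrow> 'a set set \<Rightarrow> bool" where
  "right_uniform_covering G T \<U> \<longleftrightarrow>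
    \<U> \<subseteq> Pow (carrier G) \<and>
    (\<exists>V W. openin T W \<and> \<one>\<^bsub>G\<^esub> \<in> W \<and> W \<subseteq> V \<and> V \<subseteq> carrier G \<and>
       (\<forall>x\<in>carrier G. \<exists>U\<in>\<U>. V #>\<^bsub>G\<^esub> x \<subseteq> U))"

lemma (in group) group_action_restrictI:
  assumes cl: "\<And>g x. g \<in> carrier G \<Longrightarrow> x \<in> E \<Longrightarrow> f g x \<in> E"
    and one: "\<And>x. x \<in> E \<Longrightarrow> f \<one> x = x"
    and mult: "\<And>g h x. g \<in> carrier G \<Longrightarrow> h \<in> carrier G \<Longrightarrow> x \<in> E \<Longrightarrow> f (g \<otimes> h) x = f g (f h x)"
  shows "group_action G E (\<lambda>g. restrict (f g) E)"
proof -
  have bij: "restrict (f g) E \<in> Bij E" if g: "g \<in> carrier G" for g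
  proof -
    have "bij_betw (f g) E E"
    proof (rule bij_betw_byWitness[where f' = "f (inv g)"])
      show "\<forall>a\<in>E. f (inv g) (f g a) = a"
        using g by (metis inv_closed l_inv mult one)
      show "\<forall>a\<in>E. f g (f (inv g) a) = a"
        using g by (metis inv_closed r_inv mult one)
    qed (use g cl in auto)
    then show ?thesis
      by (simp add: Bij_def)
  qed
  have "(\<lambda>g. restrict (f g) E) \<in> hom G (BijGroup E)"
  proof (rule homI)
    fix g h assume gh: "g \<in> carrier G" "h \<in> carrier G"
    show "restrict (f (g \<otimes> h)) E = restrict (f g) E \<otimes>\<^bsub>BijGroup E\<^esub> restrict (f h) E"
      using bij[OF gh(1)] bij[OF gh(2)] gh
      by (auto simp: BijGroup_def compose_def mult cl)
  qed (use bij in \<open>auto simp: BijGroup_def\<close>)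
  then show ?thesis
    unfolding group_action_def group_hom_def group_hom_axioms_def
    by (simp add: group_BijGroup is_group)
qed

lemma extremely_amenable_fixed_point:
  fixes G :: "('a, 'b) monoid_scheme" and X :: "'x topology"
  assumes ea: "extremely_amenable G T"
    and X: "compact_space X" "Hausdorff_space X" "topspace X \<noteq> {}"
    and act: "continuous_action G T X \<phi>"
  shows "\<exists>x\<in>topspace X. \<forall>g\<in>carrier G. \<phi> g x = x"
proof -
  interpret continuous_action G T X \<phi> by (rule act)
  obtain x0 where x0: "x0 \<in> topspace X"
    using X(3) by blast
  define orb where "orb = (\<lambda>A. (\<lambda>a. \<phi> a x0) ` A)"
  have orb_sub: "orb A \<subseteq> topspace X" if "A \<subseteq> carrier G" for A
    using that x0 element_image unfolding orb_def by blast
  define C where "C = X closure_of (orb (carrier G))"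
  have C: "closedin X C" "C \<subseteq> topspace X"
    by (simp_all add: C_def closure_of_subset_topspace)
  have x0C: "\<phi> \<one>\<^bsub>G\<^esub> x0 \<in> C"
    using closure_of_subset[OF orb_sub[OF subset_refl]] one_closed unfolding C_def orb_def by blast
  have cont: "continuous_map X X (\<phi> g)" if g: "g \<in> carrier G" for g
  proof -
    have "continuous_map X (prod_topology T X) (\<lambda>x. (g, x))"
      using g by (simp add: continuous_map_pairedI topspace_eq_carrier)
    from continuous_map_compose[OF this continuous_act] show ?thesis
      by (simp add: o_def)
  qed
  have C_inv: "\<phi> g x \<in> C" if g: "g \<in> carrier G" and x: "x \<in> C" for g x
  proof -
    have "\<phi> g ` orb (carrier G) \<subseteq> orb (carrier G)"
      using composition_rule[OF x0 g] g unfolding orb_def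
      by (force intro: rev_image_eqI[OF m_closed])
    then show ?thesis
      using continuous_map_image_closure_subset[OF cont[OF g], of "orb (carrier G)"] x
        closure_of_mono unfolding C_def by blast
  qed
  define h where "h x = {A. A \<subseteq> carrier G \<and> x \<in> X closure_of (orb A)}" for x
  have inj: "inj_on h C"
  proof (rule inj_onI, rule ccontr)
    fix x y assume xy: "x \<in> C" "y \<in> C" "h x = h y" "x \<noteq> y"
    then obtain U V where UV: "openin X U" "openin X V" "x \<in> U" "y \<in> V" "disjnt U V"
      using X(2) C(2) unfolding Hausdorff_space_def by (meson subsetD)
    define A where "A = {a \<in> carrier G. \<phi> a x0 \<in> U}"
    have "x \<in> X closure_of (orb A)"
      unfolding in_closure_of
    proof (intro conjI allI impI)
      show "x \<in> topspace X" using xy C by blast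
      fix N assume N: "x \<in> N \<and> openin X N"
      then have "x \<in> N \<inter> U" "openin X (N \<inter> U)" using UV by auto
      then obtain z where "z \<in> orb (carrier G)" "z \<in> N \<inter> U"
        using xy(1) unfolding C_def in_closure_of by blast
      then show "\<exists>y. y \<in> orb A \<and> y \<in> N"
        unfolding orb_def A_def by blast
    qed
    then have "A \<in> h y"
      using xy(3) unfolding h_def A_def by blast
    then have "y \<in> X closure_of (orb A)"
      unfolding h_def by simp
    then obtain z where "z \<in> orb A" "z \<in> V"
      using UV unfolding in_closure_of by blast
    then show False
      using UV(5) unfolding orb_def A_def disjnt_def by blast
  qed
  define k where "k = inv_into C h"
  have kh: "k (h x) = x" if "x \<in> C" for x
    using inj that unfolding k_def by simp
  define XC where "XC = subtopology X C"
  have top_XC: "topspace XC = C"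
    using C(2) unfolding XC_def by auto
  define Y where "Y = pullback_topology (h ` C) k XC"
  have top_Y: "topspace Y = h ` C"
    unfolding Y_def topspace_pullback_topology top_XC by (auto simp: kh)
  have cont_k: "continuous_map Y XC k"
    using continuous_map_pullback[OF continuous_map_id, of "h ` C" k XC] by (simp add: Y_def o_def)
  have cont_h: "continuous_map XC Y h"
    unfolding Y_def
  proof (rule continuous_map_pullback')
    show "continuous_map XC XC (k \<circ> h)"
      by (rule continuous_map_eq[OF continuous_map_id]) (simp add: top_XC kh)
  qed (auto simp: top_XC)
  have hm: "homeomorphic_maps XC Y h k"
    unfolding homeomorphic_maps_def using cont_h cont_k by (auto simp: top_XC top_Y kh)
  then have hs: "XC homeomorphic_space Y"
    unfolding homeomorphic_space_def by blast
  have "compact_space XC"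
    unfolding XC_def by (intro compact_space_subtopology closedin_compact_space X C)
  then have Y1: "compact_space Y"
    using homeomorphic_compact_space[OF hs] by simp
  have "Hausdorff_space XC"
    unfolding XC_def by (intro Hausdorff_space_subtopology X)
  then have Y2: "Hausdorff_space Y"
    using homeomorphic_Hausdorff_space[OF hs] by simp
  define \<psi> where "\<psi> = (\<lambda>g. restrict (\<lambda>y. h (\<phi> g (k y))) (h ` C))"
  have ga: "group_action G (topspace Y) \<psi>"
    unfolding top_Y \<psi>_def
  proof (rule group_action_restrictI)
    fix y assume "y \<in> h ` C"
    then show "h (\<phi> \<one>\<^bsub>G\<^esub> (k y)) = y"
      using id_eq_one C(2) by (metis (no_types, lifting) imageE kh restrict_apply' subsetD)
  next
    fix g g' y assume g: "g \<in> carrier G" "g' \<in> carrier G" "y \<in> h ` C"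
    then obtain x where x: "x \<in> C" "y = h x" by blast
    then show "h (\<phi> (g \<otimes>\<^bsub>G\<^esub> g') (k y)) = h (\<phi> g (k (h (\<phi> g' (k y)))))"
      using composition_rule[of x g g'] g C(2) by (auto simp: kh C_inv)
  qed (auto simp: kh C_inv)
  have "continuous_map (prod_topology T Y) Y (\<lambda>(g, y). \<psi> g y)"
  proof -
    have ks: "continuous_map Y X k"
      using cont_k unfolding XC_def continuous_map_in_subtopology by blast
    have "continuous_map (prod_topology T Y) (prod_topology T X) (\<lambda>p. (fst p, k (snd p)))"
      using continuous_map_compose[OF continuous_map_snd ks]
      by (intro continuous_map_pairedI continuous_map_fst) (simp_all add: o_def)
    from continuous_map_compose[OF this continuous_act]
    have "continuous_map (prod_topology T Y) X (\<lambda>p. \<phi> (fst p) (k (snd p)))"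
      by (simp add: o_def)
    then have "continuous_map (prod_topology T Y) XC (\<lambda>p. \<phi> (fst p) (k (snd p)))"
      unfolding XC_def continuous_map_in_subtopology
      by (auto simp: top_Y topspace_eq_carrier kh C_inv)
    from continuous_map_compose[OF this cont_h]
    have "continuous_map (prod_topology T Y) Y (\<lambda>p. h (\<phi> (fst p) (k (snd p))))"
      by (simp add: o_def)
    then show ?thesis
      by (rule continuous_map_eq) (auto simp: \<psi>_def top_Y)
  qed
  then have "continuous_action G T Y \<psi>"
    by (intro continuous_action.intro ga continuous_action_axioms.intro topological_group_axioms)
  moreover have "topspace Y \<noteq> {}"
    using x0C top_Y by blast
  ultimately obtain y where y: "y \<in> topspace Y" "\<forall>g\<in>carrier G. \<psi> g y = y"
    using ea Y1 Y2 unfolding extremely_amenable_def by blast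
  then obtain x where x: "x \<in> C" "y = h x"
    unfolding top_Y by blast
  have "\<phi> g x = x" if g: "g \<in> carrier G" for g
  proof (rule inj_onD[OF inj])
    show "h (\<phi> g x) = h x"
      using y(2) g x by (auto simp: \<psi>_def kh)
  qed (use g x C_inv in auto)
  then show ?thesis
    using x C(2) by blast
qed

end

theory Submission
  imports Defs
begin

text \<open>
  Both directions compare \<open>G\<close> with a compact \<open>G\<close>-space \<open>X\<close> through an orbit map \<open>g \<mapsto> g x\<close>. Since
  \<open>v g x\<close> is uniformly close to \<open>g x\<close> for \<open>v\<close> near \<open>\<one>\<close>, orbit maps are uniformly continuous on \<open>G\<close>
  with its right uniformity, and open coverings of \<open>X\<close> pull back to uniform coverings
  (\<open>right_uniform_covering_orbit_map\<close>, by a Lebesgue number argument).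

  Suppose the covering condition holds, but \<open>X\<close> has no fixed point. By compactness finitely many open
  sets \<open>W\<close>, each disjoint from some translate \<open>e W\<close>, cover \<open>X\<close> (\<open>moved_covering\<close>). Take \<open>E\<close> to be the
  set of these \<open>e\<close> together with \<open>\<one>\<close>, and apply the condition to the pulled back covering: some point
  \<open>g x\<close> and its image under \<open>e\<close> both lie in the same \<open>W\<close>, a contradiction.

  Conversely, let \<open>G\<close> be extremely amenable. A chain construction in the style of Birkhoff and
  Kakutani turns a uniform covering into right uniformly continuous functions \<open>f U : G \<rightarrow> [0, 1]\<close>, for
  \<open>U \<in> \<U>\<close>, such that \<open>f U\<close> vanishes off \<open>U\<close> and at every point some \<open>f U\<close> has the value \<open>1\<close>
  (\<open>uniform_Urysohn\<close>). The pointwise closure of the set of right translates of \<open>f\<close> is a compact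
  \<open>G\<close>-space; a fixed point of it is a constant function, with some value \<open>c U\<close> at \<open>U\<close>. Hence a single
  translate of \<open>f\<close> is within \<open>1/2\<close> of \<open>c\<close> on the finite set \<open>E \<union> {\<one>}\<close>
  (\<open>right_translation_orbit_nearly_constant\<close>). For the \<open>U\<close> with \<open>f U g = 1\<close> this forces \<open>c U > 1/2\<close>, so
  \<open>f U\<close> is nonzero on \<open>E g\<close>, which means \<open>E g \<subseteq> U\<close>.
\<close>

section \<open>Uniformly continuous functions separating a set from a coset\<close>

text \<open>With \<open>t\<close> half of the total, this leaves at most half of the total on either side of a single
  entry, which is what the induction on chains below needs.\<close>

lemma sum_list_split_at:
  fixes ws :: "real list"
  assumes "ws \<noteq> []" "\<forall>w\<in>set ws. 0 \<le> w" "0 \<le> t" "t \<le> sum_list ws"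
  obtains us a vs where "ws = us @ a # vs" "sum_list us \<le> t" "t \<le> sum_list us + a"
proof -
  have "\<exists>us a vs. ws = us @ a # vs \<and> sum_list us \<le> t \<and> t \<le> sum_list us + a"
    using assms
  proof (induction ws arbitrary: t)
    case (Cons b ws)
    show ?case
    proof (cases "t \<le> b")
      case True
      then show ?thesis
        using Cons.prems by (intro exI[of _ "[]"]) auto
    next
      case False
      then have "ws \<noteq> []" "0 \<le> t - b" "t - b \<le> sum_list ws"
        using Cons.prems by auto
      then obtain us a vs where "ws = us @ a # vs" "sum_list us \<le> t - b" "t - b \<le> sum_list us + a"
        using Cons.IH[of "t - b"] Cons.prems(2) by auto
      then show ?thesis
        by (intro exI[of _ "b # us"] exI[of _ a] exI[of _ vs]) auto
    qed
  qed simp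
  with that show thesis by blast
qed

definition chain_weight :: "nat list \<Rightarrow> real" where
  "chain_weight ns = (\<Sum>n\<leftarrow>ns. (1/2) ^ n)"

text \<open>A chain is a list of indices into a decreasing sequence \<open>V\<close> of neighbourhoods of \<open>\<one>\<close>. A factor
  from \<open>V n\<close> costs \<open>(1/2)^n\<close>. Recording the indices instead of the group elements gives every
  chain a definite cost even though an element lies in many of the \<open>V n\<close>.\<close>

definition (in group) chain_set :: "(nat \<Rightarrow> 'a set) \<Rightarrow> nat list \<Rightarrow> 'a set" where
  "chain_set V ns = foldr (\<lambda>n A. V n <#> A) ns {\<one>}"

lemma chain_weight_simps [simp]:
  "chain_weight [] = 0" "chain_weight (n # ns) = (1/2) ^ n + chain_weight ns"
  "chain_weight (ms @ ns) = chain_weight ms + chain_weight ns"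
  by (simp_all add: chain_weight_def)

lemma chain_weight_nonneg: "0 \<le> chain_weight ns"
  by (induction ns) auto

context group
begin

lemma chain_set_simps [simp]:
  "chain_set V [] = {\<one>}" "chain_set V (n # ns) = V n <#> chain_set V ns"
  by (simp_all add: chain_set_def)

lemma chain_set_subset:
  assumes "\<And>n. V n \<subseteq> carrier G"
  shows "chain_set V ns \<subseteq> carrier G"
  by (induction ns) (simp_all add: assms set_mult_closed)

lemma chain_set_append:
  assumes "\<And>n. V n \<subseteq> carrier G"
  shows "chain_set V (ms @ ns) = chain_set V ms <#> chain_set V ns"
proof (induction ms)
  case Nil
  show ?case
    using chain_set_subset[of V ns, OF assms] by (auto simp: set_mult_def subset_iff)
next
  case (Cons m ms)
  then show ?case
    by (simp add: set_mult_assoc chain_set_subset assms)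
qed

text \<open>The key estimate behind the Birkhoff-Kakutani metrization: cheap chains stay in small
  neighbourhoods. Split the chain at an entry where half of its weight is reached. The parts to the
  left and to the right weigh less than \<open>(1/2)^(m+1)\<close>, so by induction they produce elements of
  \<open>V (m+1)\<close>; the entry itself also has index at least \<open>m+1\<close>; and a product of three elements of
  \<open>V (m+1)\<close> lies in \<open>V m\<close>.\<close>

lemma chain_set_subset_of_weight:
  assumes V: "\<And>n. V n \<subseteq> carrier G" "\<And>n. \<one> \<in> V n"
    and cube: "\<And>n. V (Suc n) <#> V (Suc n) <#> V (Suc n) \<subseteq> V n"
    and w: "chain_weight ns < (1/2) ^ m"
  shows "chain_set V ns \<subseteq> V m"
  using w
proof (induction "length ns" arbitrary: ns m rule: less_induct)
  case less
  have step: "V (Suc n) \<subseteq> V n" for n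
  proof
    fix x assume x: "x \<in> V (Suc n)"
    then have "\<one> \<otimes> \<one> \<otimes> x \<in> V (Suc n) <#> V (Suc n) <#> V (Suc n)"
      using V(2)[of "Suc n"] unfolding set_mult_def by blast
    moreover have "x \<in> carrier G"
      using x V(1) by blast
    ultimately show "x \<in> V n"
      using cube[of n] by auto
  qed
  have anti: "V k \<subseteq> V n" if "n \<le> k" for n k
    using that by (induction k rule: dec_induct) (use step in blast)+
  show ?case
  proof (cases "ns = []")
    case True
    then show ?thesis using V(2) by simp
  next
    case False
    define s where "s = chain_weight ns"
    obtain us a vs where split: "map (\<lambda>n. (1/2) ^ n) ns = us @ a # vs"
      and le: "sum_list us \<le> s / 2" "s / 2 \<le> sum_list us + a"
    proof (rule sum_list_split_at)
      show "map (\<lambda>n. (1/2::real) ^ n) ns \<noteq> []"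
        using False by simp
      show "0 \<le> s / 2"
        using chain_weight_nonneg[of ns] by (simp add: s_def)
      show "s / 2 \<le> sum_list (map (\<lambda>n. (1/2) ^ n) ns)"
        using chain_weight_nonneg[of ns] by (simp add: s_def chain_weight_def)
    qed auto
    then obtain xs n ys where ns: "ns = xs @ n # ys" "us = map (\<lambda>n. (1/2) ^ n) xs"
      "a = (1/2) ^ n" "vs = map (\<lambda>n. (1/2) ^ n) ys"
      by (auto simp: map_eq_append_conv map_eq_Cons_conv)
    have s: "s = chain_weight xs + (1/2) ^ n + chain_weight ys" "s < (1/2) ^ m"
      using less.prems by (simp_all add: s_def ns)
    have le': "chain_weight xs \<le> s / 2" "s / 2 \<le> chain_weight xs + (1/2) ^ n"
      using le by (simp_all add: ns chain_weight_def)
    have "chain_set V xs \<subseteq> V (Suc m)"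
      by (rule less.hyps) (use s le' in \<open>simp_all add: ns\<close>)
    moreover have "chain_set V ys \<subseteq> V (Suc m)"
      by (rule less.hyps) (use s le' in \<open>simp_all add: ns\<close>)
    moreover have "V n \<subseteq> V (Suc m)"
    proof (rule anti)
      have "(1/2::real) ^ n < (1/2) ^ m"
        using s chain_weight_nonneg[of xs] chain_weight_nonneg[of ys] by linarith
      then have "m < n"
        by (subst (asm) power_strict_decreasing_iff) auto
      then show "Suc m \<le> n"
        by simp
    qed
    ultimately have "chain_set V ns \<subseteq> V (Suc m) <#> V (Suc m) <#> V (Suc m)"
      unfolding ns by (simp add: chain_set_append set_mult_assoc V mono_set_mult)
    then show ?thesis
      using cube[of m] by blast
  qed
qed

end

context topological_group
begin

lemma continuous_map_mult:
  assumes "continuous_map X T f" "continuous_map X T g"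
  shows "continuous_map X T (\<lambda>x. f x \<otimes> g x)"
  using continuous_map_compose[OF continuous_map_pairedI[OF assms] continuous_mult]
  by (simp add: o_def)

lemma symmetric_cube_root_neighbourhood:
  assumes W: "openin T W" "\<one> \<in> W"
  obtains V where "openin T V" "\<one> \<in> V" "\<And>v. v \<in> V \<Longrightarrow> inv v \<in> V" "V <#> V <#> V \<subseteq> W"
proof -
  let ?P = "prod_topology T (prod_topology T T)"
  have "continuous_map ?P T (\<lambda>p. fst p \<otimes> fst (snd p) \<otimes> snd (snd p))"
    by (intro continuous_map_mult continuous_map_fst continuous_map_fst_of continuous_map_snd_of
        continuous_map_compose[OF continuous_map_snd continuous_map_fst, unfolded o_def]
        continuous_map_compose[OF continuous_map_snd continuous_map_snd, unfolded o_def])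
  from openin_continuous_map_preimage[OF this W(1)]
  have "openin ?P {p \<in> topspace ?P. fst p \<otimes> fst (snd p) \<otimes> snd (snd p) \<in> W}" (is "openin ?P ?S") .
  moreover have "(\<one>, \<one>, \<one>) \<in> ?S"
    using W(2) by (simp add: topspace_eq_carrier)
  ultimately obtain A BC where A: "openin T A" "\<one> \<in> A" "openin (prod_topology T T) BC"
      "(\<one>, \<one>) \<in> BC" "A \<times> BC \<subseteq> ?S"
    unfolding openin_prod_topology_alt by meson
  then obtain B C where B: "openin T B" "\<one> \<in> B" "openin T C" "\<one> \<in> C" "B \<times> C \<subseteq> BC"
    unfolding openin_prod_topology_alt[of T T] by meson
  define D where "D = A \<inter> B \<inter> C"
  have D: "openin T D" "\<one> \<in> D" "D \<subseteq> carrier G"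
    using A B openin_subset[OF A(1)] by (auto simp: D_def topspace_eq_carrier)
  define V where "V = D \<inter> {v \<in> topspace T. inv v \<in> D}"
  show thesis
  proof
    show "openin T V"
      unfolding V_def
      by (intro openin_Int D openin_continuous_map_preimage[OF continuous_inv])
    show "\<one> \<in> V"
      using D by (simp add: V_def topspace_eq_carrier)
    show "inv v \<in> V" if "v \<in> V" for v
      using that D by (auto simp: V_def topspace_eq_carrier)
    show "V <#> V <#> V \<subseteq> W"
    proof
      fix x assume "x \<in> V <#> V <#> V"
      then obtain a b c where "x = a \<otimes> b \<otimes> c" "a \<in> D" "b \<in> D" "c \<in> D"
        by (auto simp: set_mult_def V_def)
      then have "(a, b, c) \<in> A \<times> BC"
        using B(5) by (auto simp: D_def)
      then have "(a, b, c) \<in> ?S"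
        using A(5) by blast
      then show "x \<in> W"
        using \<open>x = a \<otimes> b \<otimes> c\<close> by simp
    qed
  qed
qed

lemma neighbourhood_sequence:
  assumes W: "openin T W" "\<one> \<in> W"
  obtains V :: "nat \<Rightarrow> 'a set" where "V 0 \<subseteq> W" "\<And>n. openin T (V n)" "\<And>n. \<one> \<in> V n"
    "\<And>n v. v \<in> V n \<Longrightarrow> inv v \<in> V n" "\<And>n. V (Suc n) <#> V (Suc n) <#> V (Suc n) \<subseteq> V n"
proof -
  let ?sym = "\<lambda>V. openin T V \<and> \<one> \<in> V \<and> (\<forall>v\<in>V. inv v \<in> V)"
  have "\<exists>V. \<forall>n. (?sym (V n) \<and> (n = (0::nat) \<longrightarrow> V n \<subseteq> W)) \<and>
      V (Suc n) <#> V (Suc n) <#> V (Suc n) \<subseteq> V n"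
  proof (rule dependent_nat_choice)
    obtain V where V: "openin T V" "\<one> \<in> V" "\<And>v. v \<in> V \<Longrightarrow> inv v \<in> V" "V <#> V <#> V \<subseteq> W"
      by (rule symmetric_cube_root_neighbourhood[OF W], rule that)
    have "V \<subseteq> V <#> V <#> V"
    proof
      fix x assume x: "x \<in> V"
      then have "x \<in> carrier G"
        using openin_subset[OF V(1)] topspace_eq_carrier by auto
      moreover have "\<one> \<otimes> \<one> \<otimes> x \<in> V <#> V <#> V"
        using x V(2) unfolding set_mult_def by blast
      ultimately show "x \<in> V <#> V <#> V" by simp
    qed
    then show "\<exists>V. ?sym V \<and> (0 = (0::nat) \<longrightarrow> V \<subseteq> W)"
      using V by blast
  next
    fix V and n :: nat assume "?sym V \<and> (n = 0 \<longrightarrow> V \<subseteq> W)"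
    then obtain V' where "openin T V'" "\<one> \<in> V'" "\<And>v. v \<in> V' \<Longrightarrow> inv v \<in> V'" "V' <#> V' <#> V' \<subseteq> V"
      using symmetric_cube_root_neighbourhood[of V] by metis
    then show "\<exists>V'. (?sym V' \<and> (Suc n = 0 \<longrightarrow> V' \<subseteq> W)) \<and> V' <#> V' <#> V' \<subseteq> V"
      by blast
  qed
  then obtain V where V: "\<forall>n. (?sym (V n) \<and> (n = (0::nat) \<longrightarrow> V n \<subseteq> W)) \<and>
      V (Suc n) <#> V (Suc n) <#> V (Suc n) \<subseteq> V n" ..
  show thesis
  proof (rule that[of V])
    show "V 0 \<subseteq> W" using V by simp
  qed (use V in simp_all)
qed

definition right_uniformly_continuous :: "('a \<Rightarrow> real) \<Rightarrow> bool" where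
  "right_uniformly_continuous f \<longleftrightarrow>
    (\<forall>\<epsilon>>0. \<exists>W. openin T W \<and> \<one> \<in> W \<and> (\<forall>v\<in>W. \<forall>x\<in>carrier G. \<bar>f (v \<otimes> x) - f x\<bar> \<le> \<epsilon>))"

text \<open>A Urysohn function for the right uniformity: \<open>f x\<close> is the least cost, capped at \<open>1\<close>, of a chain
  that can carry \<open>x\<close> out of \<open>U\<close> by left multiplication. Moving \<open>x\<close> to \<open>v x\<close> with \<open>v \<in> V n\<close> lengthens a
  chain by one factor and so changes \<open>f\<close> by at most \<open>(1/2)^n\<close>. If \<open>W x \<subseteq> U\<close>, no chain of cost below
  \<open>1\<close> leads out of \<open>U\<close>.\<close>

lemma uniform_Urysohn:
  assumes W: "openin T W" "\<one> \<in> W"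
  obtains f where "right_uniformly_continuous f" "\<And>x. f x \<in> {0..1}"
    "\<And>x. x \<in> carrier G \<Longrightarrow> x \<notin> U \<Longrightarrow> f x = 0"
    "\<And>x. x \<in> carrier G \<Longrightarrow> W #> x \<subseteq> U \<Longrightarrow> f x = 1"
proof -
  obtain V :: "nat \<Rightarrow> 'a set" where V: "V 0 \<subseteq> W" "\<And>n. openin T (V n)" "\<And>n. \<one> \<in> V n"
    "\<And>n v. v \<in> V n \<Longrightarrow> inv v \<in> V n" "\<And>n. V (Suc n) <#> V (Suc n) <#> V (Suc n) \<subseteq> V n"
    by (rule neighbourhood_sequence[OF W], rule that)
  have VG: "V n \<subseteq> carrier G" for n
    using openin_subset[OF V(2)] by (simp add: topspace_eq_carrier)
  define S where "S x = insert 1 (chain_weight ` {ns. \<not> chain_set V ns #> x \<subseteq> U})" for x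
  define f where "f x = Inf (S x)" for x
  have S_nonneg: "0 \<le> s" if "s \<in> S x" for s x
    using that chain_weight_nonneg by (auto simp: S_def)
  have bdd: "bdd_below (S x)" for x
    using S_nonneg by (rule bdd_belowI)
  have ne: "S x \<noteq> {}" for x
    by (simp add: S_def)
  have f_le: "f x \<le> s" if "s \<in> S x" for s x
    unfolding f_def using that bdd by (rule cInf_lower)
  have f_ge: "t \<le> f x" if "\<And>s. s \<in> S x \<Longrightarrow> t \<le> s" for t x
    unfolding f_def using that ne by (intro cInf_greatest)
  have move: "f x \<le> (1/2) ^ n + f (v \<otimes> x)" if v: "v \<in> V n" and x: "x \<in> carrier G" for n v x
  proof -
    have "f x - (1/2) ^ n \<le> f (v \<otimes> x)"
    proof (rule f_ge)
      fix s assume "s \<in> S (v \<otimes> x)"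
      then consider "s = 1" | ns where "s = chain_weight ns" "\<not> chain_set V ns #> (v \<otimes> x) \<subseteq> U"
        by (auto simp: S_def)
      then show "f x - (1/2) ^ n \<le> s"
      proof cases
        case 1
        have "f x \<le> 1" by (rule f_le) (simp add: S_def)
        moreover have "0 \<le> (1/2::real) ^ n" by simp
        ultimately show ?thesis
          using 1 by linarith
      next
        case 2
        then obtain p where p: "p \<in> chain_set V ns" "p \<otimes> (v \<otimes> x) \<notin> U"
          by (auto simp: r_coset_def)
        have c: "p \<in> carrier G" "v \<in> carrier G"
          using p(1) v chain_set_subset[of V ns, OF VG] VG by auto
        have "p \<otimes> v \<in> chain_set V (ns @ [n])"
          using p(1) v VG by (auto simp: chain_set_append set_mult_def subset_iff)
        moreover have "p \<otimes> v \<otimes> x \<notin> U"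
          using p(2) c x by (simp add: m_assoc)
        ultimately have "\<not> chain_set V (ns @ [n]) #> x \<subseteq> U"
          by (auto simp: r_coset_def)
        then have "chain_weight (ns @ [n]) \<in> S x"
          unfolding S_def by blast
        from f_le[OF this] show ?thesis
          using 2 by simp
      qed
    qed
    then show ?thesis by linarith
  qed
  show thesis
  proof
    show "right_uniformly_continuous f"
      unfolding right_uniformly_continuous_def
    proof (intro allI impI)
      fix \<epsilon> :: real assume "0 < \<epsilon>"
      then obtain n where n: "(1/2) ^ n < \<epsilon>"
        using real_arch_pow_inv[of \<epsilon> "1/2"] by auto
      have "\<bar>f (v \<otimes> x) - f x\<bar> \<le> \<epsilon>" if v: "v \<in> V n" and x: "x \<in> carrier G" for v x
      proof -
        have "v \<in> carrier G" using v VG by blast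
        \<comment> \<open>The other inequality comes from moving back along \<open>inv v\<close>, by symmetry of \<open>V n\<close>.\<close>
        then have "f (v \<otimes> x) \<le> (1/2) ^ n + f x"
          using move[OF V(4)[OF v], of "v \<otimes> x"] x by (simp add: m_assoc[symmetric])
        then show ?thesis
          using move[OF v x] n by linarith
      qed
      then show "\<exists>W. openin T W \<and> \<one> \<in> W \<and> (\<forall>v\<in>W. \<forall>x\<in>carrier G. \<bar>f (v \<otimes> x) - f x\<bar> \<le> \<epsilon>)"
        using V(2)[of n] V(3)[of n] by blast
    qed
    show "f x \<in> {0..1}" for x
      using f_ge[of x 0] f_le[of 1 x] S_nonneg by (auto simp: S_def)
    show "f x = 0" if "x \<in> carrier G" "x \<notin> U" for x
    proof -
      have "chain_weight [] \<in> S x"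
        using that unfolding S_def by (intro insertI2 imageI) (simp add: r_coset_def)
      then show ?thesis
        using f_le[of 0 x] f_ge[of x 0] S_nonneg by force
    qed
    show "f x = 1" if x: "x \<in> carrier G" "W #> x \<subseteq> U" for x
    proof (rule antisym)
      show "f x \<le> 1" by (rule f_le) (simp add: S_def)
      show "1 \<le> f x"
      proof (rule f_ge)
        fix s assume "s \<in> S x"
        then consider "s = 1" | ns where "s = chain_weight ns" "\<not> chain_set V ns #> x \<subseteq> U"
          by (auto simp: S_def)
        then show "1 \<le> s"
        proof cases
          case 2
          then have "\<not> chain_set V ns \<subseteq> V 0"
            using x(2) V(1) by (auto simp: r_coset_def)
          then show ?thesis
            using chain_set_subset_of_weight[where V = V and m = 0 and ns = ns, OF VG V(3) V(5)] 2
            by fastforce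
        qed simp
      qed
    qed
  qed
qed

end

section \<open>The flow of right translates of a family of functions\<close>

context topological_group
begin

text \<open>Regard the family as one point of the cube \<open>[0, 1]^('i \<times> G)\<close>, on which \<open>G\<close> acts by
  \<open>(g \<psi>) (i, h) = \<psi> (i, h g)\<close>. In general this action is not jointly continuous on the whole cube, but on the
  closure \<open>C\<close> of the orbit it is: right translation commutes with the left multiplications that
  measure right uniform continuity, so all members of \<open>C\<close> share the moduli of continuity of the
  family. A fixed point of the compact space \<open>C\<close> is constant in \<open>h\<close>, and it is approximated at
  finitely many coordinates by translates of the family.\<close>

lemma right_translation_orbit_nearly_constant:
  fixes f :: "'i \<Rightarrow> 'a \<Rightarrow> real"
  assumes ea: "extremely_amenable G T"
    and unif: "\<And>i. right_uniformly_continuous (f i)"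
    and bounds: "\<And>i x. f i x \<in> {0..1}"
  obtains c where "\<And>E F \<epsilon>. \<lbrakk>finite E; E \<subseteq> carrier G; finite F; 0 < \<epsilon>\<rbrakk> \<Longrightarrow>
    \<exists>g\<in>carrier G. \<forall>i\<in>F. \<forall>x\<in>E. \<bar>f i (x \<otimes> g) - c i\<bar> < \<epsilon>"
proof -
  define J where "J = (UNIV :: 'i set) \<times> carrier G"
  define P where "P = product_topology (\<lambda>_. top_of_set {0..1::real}) J"
  define tr where "tr g \<psi> = (\<lambda>(i, h)\<in>J. \<psi> (i, h \<otimes> g))" for g and \<psi> :: "'i \<times> 'a \<Rightarrow> real"
  define orb where "orb = (\<lambda>g. \<lambda>(i, h)\<in>J. f i (h \<otimes> g)) ` carrier G"
  define C where "C = P closure_of orb"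
  define X where "X = subtopology P C"
  have top_P: "topspace P = (\<Pi>\<^sub>E _\<in>J. {0..1})"
    by (simp add: P_def)
  have C: "closedin P C" "C \<subseteq> topspace P"
    by (simp_all add: C_def closure_of_subset_topspace)
  have top_X: "topspace X = C"
    using C by (auto simp: X_def)
  have orb_P: "orb \<subseteq> topspace P"
    using bounds by (auto simp: orb_def top_P)
  then have orb_C: "orb \<subseteq> C"
    unfolding C_def by (rule closure_of_subset)
  have coord_P: "continuous_map P euclideanreal (\<lambda>\<psi>. \<psi> j)" if "j \<in> J" for j
    using continuous_map_product_projection[OF that, of "\<lambda>_. top_of_set {0..1::real}"]
    by (simp add: P_def continuous_map_in_subtopology)
  have P: "compact_space P" "Hausdorff_space P"
    by (simp_all add: P_def compact_space_product_topology Hausdorff_space_product_topology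
        Hausdorff_space_subtopology compact_space_subtopology)
  have X: "compact_space X" "Hausdorff_space X" "topspace X \<noteq> {}"
    using orb_C one_closed top_X
    by (auto simp: X_def orb_def P C intro!: compact_space_subtopology closedin_compact_space
        Hausdorff_space_subtopology)
  \<comment> \<open>Equicontinuity survives passing to pointwise limits.\<close>
  have equi: "\<exists>W. openin T W \<and> \<one> \<in> W \<and>
      (\<forall>\<psi>\<in>C. \<forall>v\<in>W. \<forall>x\<in>carrier G. \<bar>\<psi> (i, v \<otimes> x) - \<psi> (i, x)\<bar> \<le> \<epsilon>)" if \<epsilon>: "0 < \<epsilon>" for i \<epsilon>
  proof -
    obtain W where W: "openin T W" "\<one> \<in> W"
      "\<And>v x. v \<in> W \<Longrightarrow> x \<in> carrier G \<Longrightarrow> \<bar>f i (v \<otimes> x) - f i x\<bar> \<le> \<epsilon>"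
      using unif[of i, unfolded right_uniformly_continuous_def, rule_format, OF \<epsilon>] by blast
    have "\<bar>\<psi> (i, v \<otimes> x) - \<psi> (i, x)\<bar> \<le> \<epsilon>"
      if \<psi>: "\<psi> \<in> C" and v: "v \<in> W" and x: "x \<in> carrier G" for \<psi> v x
    proof -
      have vG: "v \<in> carrier G"
        using v openin_subset[OF W(1)] topspace_eq_carrier by auto
      let ?D = "{\<psi> \<in> topspace P. \<psi> (i, v \<otimes> x) - \<psi> (i, x) \<in> {-\<epsilon>..\<epsilon>}}"
      have "closedin P ?D"
        by (rule closedin_continuous_map_preimage[where Y = euclideanreal])
          (auto intro!: continuous_map_diff coord_P simp: J_def vG x)
      moreover have "orb \<subseteq> ?D"
      proof
        fix \<psi> assume o: "\<psi> \<in> orb"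
        then obtain g where g: "g \<in> carrier G" "\<psi> = (\<lambda>(i, h)\<in>J. f i (h \<otimes> g))"
          by (auto simp: orb_def)
        have "\<bar>f i (v \<otimes> (x \<otimes> g)) - f i (x \<otimes> g)\<bar> \<le> \<epsilon>"
          using W(3) v x g by simp
        then show "\<psi> \<in> ?D"
          using o orb_P g vG x by (auto simp: J_def m_assoc abs_le_iff)
      qed
      ultimately have "C \<subseteq> ?D"
        unfolding C_def by (rule closure_of_minimal[rotated])
      then show ?thesis
        using \<psi> by (auto simp: abs_le_iff)
    qed
    then show ?thesis using W by blast
  qed
  have tr_C: "tr g \<psi> \<in> C" if g: "g \<in> carrier G" and \<psi>: "\<psi> \<in> C" for g \<psi>
  proof -
    have "continuous_map P P (tr g)"
      unfolding P_def continuous_map_componentwise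
    proof (intro conjI ballI)
      show "tr g ` topspace (product_topology (\<lambda>_. top_of_set {0..1}) J) \<subseteq> extensional J"
        by (auto simp: tr_def)
      fix j assume "j \<in> J"
      then obtain i h where j: "j = (i, h)" "h \<in> carrier G" by (auto simp: J_def)
      have "continuous_map (product_topology (\<lambda>_. top_of_set {0..1::real}) J) (top_of_set {0..1})
          (\<lambda>\<psi>. \<psi> (i, h \<otimes> g))"
        using j g by (intro continuous_map_product_projection) (simp add: J_def)
      then show "continuous_map (product_topology (\<lambda>_. top_of_set {0..1}) J) (top_of_set {0..1})
          (\<lambda>\<psi>. tr g \<psi> j)"
        using \<open>j \<in> J\<close> by (simp add: tr_def j)
    qed
    from continuous_map_image_closure_subset[OF this, of orb]
    have "tr g \<psi> \<in> P closure_of (tr g ` orb)"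
      using \<psi> unfolding C_def by blast
    moreover have "tr g ` orb \<subseteq> orb"
    proof
      fix \<psi> assume "\<psi> \<in> tr g ` orb"
      then obtain k where k: "k \<in> carrier G" "\<psi> = tr g (\<lambda>(i, h)\<in>J. f i (h \<otimes> k))"
        by (auto simp: orb_def)
      have "\<psi> = (\<lambda>(i, h)\<in>J. f i (h \<otimes> (g \<otimes> k)))"
        unfolding k tr_def using g k by (intro restrict_ext) (auto simp: J_def m_assoc)
      then show "\<psi> \<in> orb"
        using g k unfolding orb_def by blast
    qed
    ultimately show ?thesis
      unfolding C_def using closure_of_mono by blast
  qed
  define act where "act g = restrict (tr g) C" for g
  have "group_action G C act"
    unfolding act_def
  proof (rule group_action_restrictI)
    fix \<psi> assume "\<psi> \<in> C"
    then have "\<psi> \<in> extensional J"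
      using C(2) by (auto simp: top_P PiE_def)
    then show "tr \<one> \<psi> = \<psi>"
      by (intro extensionalityI[of _ J]) (auto simp: tr_def J_def)
  next
    fix g h \<psi> assume "g \<in> carrier G" "h \<in> carrier G"
    then show "tr (g \<otimes> h) \<psi> = tr g (tr h \<psi>)"
      by (auto simp: tr_def J_def m_assoc fun_eq_iff restrict_def)
  qed (rule tr_C)
  moreover have "continuous_map (prod_topology T X) X (\<lambda>(g, \<psi>). act g \<psi>)"
  proof -
    have coord: "continuous_map (prod_topology T X) euclideanreal (\<lambda>p. snd p (i, h \<otimes> fst p))"
      if h: "h \<in> carrier G" for i h
      unfolding mtopology_is_euclidean[symmetric] Met_TC.continuous_map_to_metric
    proof (intro ballI allI impI)
      fix p and \<epsilon> :: real
      assume "p \<in> topspace (prod_topology T X)" and \<epsilon>: "0 < \<epsilon>"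
      then obtain g0 \<psi>0 where p: "p = (g0, \<psi>0)" "g0 \<in> carrier G" "\<psi>0 \<in> C"
        by (cases p) (auto simp: topspace_eq_carrier top_X)
      obtain W where W: "openin T W" "\<one> \<in> W"
        "\<And>\<psi> v x. \<psi> \<in> C \<Longrightarrow> v \<in> W \<Longrightarrow> x \<in> carrier G \<Longrightarrow> \<bar>\<psi> (i, v \<otimes> x) - \<psi> (i, x)\<bar> \<le> \<epsilon> / 2"
        using equi[of "\<epsilon> / 2" i] \<epsilon> by auto
      \<comment> \<open>The element \<open>u g\<close> satisfies \<open>u g \<otimes> (h \<otimes> g0) = h \<otimes> g\<close>, so moving \<open>g0\<close> to \<open>g\<close> is a left
        multiplication of the argument, which the equicontinuity controls uniformly in \<open>\<psi>\<close>.\<close>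
      define u where "u g = h \<otimes> g \<otimes> inv (h \<otimes> g0)" for g
      define A where "A = {g \<in> topspace T. u g \<in> W}"
      define B where "B = {\<psi> \<in> topspace X. \<psi> (i, h \<otimes> g0) \<in> ball (\<psi>0 (i, h \<otimes> g0)) (\<epsilon> / 2)}"
      have "continuous_map T T u"
        unfolding u_def using h p
        by (intro continuous_map_mult) (auto simp: topspace_eq_carrier)
      then have "openin T A"
        unfolding A_def using W(1) by (rule openin_continuous_map_preimage)
      moreover have "openin X B"
        unfolding B_def X_def using h p
        by (intro openin_continuous_map_preimage[where Y = euclideanreal]
            continuous_map_from_subtopology coord_P) (auto simp: J_def)
      moreover have "g0 \<in> A" "\<psi>0 \<in> B"
        using p h W(2) \<epsilon> by (auto simp: A_def B_def u_def topspace_eq_carrier top_X)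
      moreover have "snd q (i, h \<otimes> fst q) \<in> ball (snd p (i, h \<otimes> fst p)) \<epsilon>" if qAB: "q \<in> A \<times> B" for q
      proof -
        obtain g \<psi> where "q = (g, \<psi>)" "g \<in> A" "\<psi> \<in> B"
          using qAB by blast
        then have q: "q = (g, \<psi>)" "g \<in> carrier G" "u g \<in> W" "\<psi> \<in> C"
          "\<bar>\<psi>0 (i, h \<otimes> g0) - \<psi> (i, h \<otimes> g0)\<bar> < \<epsilon> / 2"
          by (simp_all add: A_def B_def topspace_eq_carrier top_X dist_real_def)
        have "u g \<otimes> (h \<otimes> g0) = h \<otimes> g"
          using q h p by (simp add: u_def m_assoc)
        then have "\<bar>\<psi> (i, h \<otimes> g) - \<psi> (i, h \<otimes> g0)\<bar> \<le> \<epsilon> / 2"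
          using W(3)[OF q(4) q(3), of "h \<otimes> g0"] h p by simp
        then have "\<bar>\<psi>0 (i, h \<otimes> g0) - \<psi> (i, h \<otimes> g)\<bar> < \<epsilon>"
          using q(5) by linarith
        then show ?thesis
          by (simp add: p q dist_real_def)
      qed
      ultimately show "\<exists>U. openin (prod_topology T X) U \<and> p \<in> U \<and>
          (\<forall>q\<in>U. snd q (i, h \<otimes> fst q) \<in> Met_TC.mball (snd p (i, h \<otimes> fst p)) \<epsilon>)"
        unfolding mball_eq_ball
        by (intro exI[of _ "A \<times> B"]) (auto simp: openin_prod_Times_iff p(1))
    qed
    have "continuous_map (prod_topology T X) P (\<lambda>p. tr (fst p) (snd p))"
      unfolding P_def continuous_map_componentwise
    proof (intro conjI ballI)
      show "(\<lambda>p. tr (fst p) (snd p)) ` topspace (prod_topology T X) \<subseteq> extensional J"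
        by (auto simp: tr_def)
      fix j assume "j \<in> J"
      then obtain i h where j: "j = (i, h)" "h \<in> carrier G" by (auto simp: J_def)
      have "continuous_map (prod_topology T X) (top_of_set {0..1}) (\<lambda>p. snd p (i, h \<otimes> fst p))"
      proof (rule continuous_map_into_subtopology[OF coord[OF j(2)]], rule funcsetI)
        fix p assume "p \<in> topspace (prod_topology T X)"
        then have "snd p \<in> topspace P" "(i, h \<otimes> fst p) \<in> J"
          using C(2) j by (auto simp: top_X topspace_eq_carrier J_def)
        then show "snd p (i, h \<otimes> fst p) \<in> {0..1}"
          unfolding top_P by (rule PiE_mem)
      qed
      then show "continuous_map (prod_topology T X) (top_of_set {0..1})
          (\<lambda>p. tr (fst p) (snd p) j)"
        using \<open>j \<in> J\<close> by (simp add: tr_def j)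
    qed
    then have "continuous_map (prod_topology T X) X (\<lambda>p. tr (fst p) (snd p))"
      unfolding X_def continuous_map_in_subtopology
      using tr_C C(2) by (auto simp: topspace_eq_carrier)
    then show ?thesis
      by (rule continuous_map_eq) (auto simp: act_def top_X)
  qed
  ultimately have "continuous_action G T X act"
    by (intro continuous_action.intro continuous_action_axioms.intro topological_group_axioms)
      (simp_all add: top_X)
  from extremely_amenable_fixed_point[OF ea X this]
  obtain \<psi> where \<psi>: "\<psi> \<in> C" "\<And>g. g \<in> carrier G \<Longrightarrow> tr g \<psi> = \<psi>"
    by (auto simp: top_X act_def)
  have const: "\<psi> (i, g) = \<psi> (i, \<one>)" if "g \<in> carrier G" for i g
    using fun_cong[OF \<psi>(2)[OF that], of "(i, \<one>)"] that by (simp add: tr_def J_def)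
  show thesis
  proof
    fix E :: "'a set" and F :: "'i set" and \<epsilon> :: real
    assume E: "finite E" "E \<subseteq> carrier G" and F: "finite F" and \<epsilon>: "0 < \<epsilon>"
    let ?N = "topspace P \<inter> (\<Inter>j\<in>F \<times> E. {\<theta> \<in> topspace P. \<theta> j \<in> ball (\<psi> j) \<epsilon>})"
    have "openin P {\<theta> \<in> topspace P. \<theta> j \<in> ball (\<psi> j) \<epsilon>}" if "j \<in> F \<times> E" for j
      by (rule openin_continuous_map_preimage[OF coord_P]) (use that E(2) in \<open>auto simp: J_def\<close>)
    then have "openin P ?N"
      using E F by (intro openin_Int_Inter) auto
    moreover have "\<psi> \<in> ?N"
      using \<psi>(1) C(2) \<epsilon> by auto
    ultimately obtain \<theta> where "\<theta> \<in> orb" "\<theta> \<in> ?N"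
      using \<psi>(1) unfolding C_def in_closure_of by blast
    then obtain g where g: "g \<in> carrier G" "\<theta> = (\<lambda>(i, h)\<in>J. f i (h \<otimes> g))"
      by (auto simp: orb_def)
    have "\<bar>f i (x \<otimes> g) - \<psi> (i, \<one>)\<bar> < \<epsilon>" if i: "i \<in> F" and x: "x \<in> E" for i x
    proof -
      have "\<theta> (i, x) \<in> ball (\<psi> (i, x)) \<epsilon>"
        using \<open>\<theta> \<in> ?N\<close> i x by blast
      moreover have "\<theta> (i, x) = f i (x \<otimes> g)"
        using x E(2) by (auto simp: g J_def)
      ultimately show ?thesis
        using const[of x i] x E(2) by (auto simp: dist_real_def abs_minus_commute)
    qed
    then show "\<exists>g\<in>carrier G. \<forall>i\<in>F. \<forall>x\<in>E. \<bar>f i (x \<otimes> g) - \<psi> (i, \<one>)\<bar> < \<epsilon>"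
      using g by blast
  qed
qed

lemma extremely_amenable_imp_translate_in_covering:
  assumes ea: "extremely_amenable G T"
    and E: "finite E" "E \<subseteq> carrier G"
    and \<U>: "finite \<U>" "right_uniform_covering G T \<U>"
  shows "\<exists>g\<in>carrier G. \<exists>U\<in>\<U>. E #> g \<subseteq> U"
proof -
  from \<U>(2)[unfolded right_uniform_covering_def, THEN conjunct2]
  obtain V W where VW: "openin T W \<and> \<one> \<in> W \<and> W \<subseteq> V \<and> V \<subseteq> carrier G \<and>
      (\<forall>x\<in>carrier G. \<exists>U\<in>\<U>. V #> x \<subseteq> U)"
    by (elim exE) (rule that)
  then have W: "openin T W" "\<one> \<in> W" "W \<subseteq> V"
    by simp_all
  have V: "\<exists>U\<in>\<U>. V #> x \<subseteq> U" if "x \<in> carrier G" for x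
    using VW that by simp
  have "\<exists>f. right_uniformly_continuous f \<and> (\<forall>x. f x \<in> {0..1}) \<and>
      (\<forall>x\<in>carrier G. (x \<notin> U \<longrightarrow> f x = 0) \<and> (W #> x \<subseteq> U \<longrightarrow> f x = 1))" for U
    by (rule uniform_Urysohn[OF W(1,2), of U]) blast
  then have "\<forall>U. \<exists>f. right_uniformly_continuous f \<and> (\<forall>x. f x \<in> {0..1}) \<and>
      (\<forall>x\<in>carrier G. (x \<notin> U \<longrightarrow> f x = 0) \<and> (W #> x \<subseteq> U \<longrightarrow> f x = 1))" ..
  from choice[OF this] obtain f where "\<forall>U. right_uniformly_continuous (f U) \<and>
      (\<forall>x. f U x \<in> {0..1}) \<and>
      (\<forall>x\<in>carrier G. (x \<notin> U \<longrightarrow> f U x = 0) \<and> (W #> x \<subseteq> U \<longrightarrow> f U x = 1))" ..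
  then have f: "\<And>U. right_uniformly_continuous (f U)" "\<And>U x. f U x \<in> {0..1}"
    "\<And>U x. x \<in> carrier G \<Longrightarrow> x \<notin> U \<Longrightarrow> f U x = 0"
    "\<And>U x. x \<in> carrier G \<Longrightarrow> W #> x \<subseteq> U \<Longrightarrow> f U x = 1"
    by simp_all
  obtain c where c: "\<And>E F \<epsilon>. \<lbrakk>finite E; E \<subseteq> carrier G; finite F; 0 < \<epsilon>\<rbrakk> \<Longrightarrow>
      \<exists>g\<in>carrier G. \<forall>U\<in>F. \<forall>x\<in>E. \<bar>f U (x \<otimes> g) - c U\<bar> < \<epsilon>"
    by (rule right_translation_orbit_nearly_constant[of f, OF ea f(1,2)], rule that)
  \<comment> \<open>The point \<open>\<one>\<close> is added to \<open>E\<close> so that the value \<open>1\<close> attained at \<open>g\<close> bounds \<open>c\<close> from below.\<close>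
  have "\<exists>g\<in>carrier G. \<forall>U\<in>\<U>. \<forall>x\<in>insert \<one> E. \<bar>f U (x \<otimes> g) - c U\<bar> < 1/2"
    by (rule c) (use E \<U>(1) in auto)
  then obtain g where g: "g \<in> carrier G"
    "\<And>U x. U \<in> \<U> \<Longrightarrow> x \<in> insert \<one> E \<Longrightarrow> \<bar>f U (x \<otimes> g) - c U\<bar> < 1/2"
    by blast
  obtain U where U: "U \<in> \<U>" "V #> g \<subseteq> U"
    using V[OF g(1)] by blast
  have "W #> g \<subseteq> U"
    using U W(3) by (auto simp: r_coset_def)
  then have "f U (\<one> \<otimes> g) = 1"
    using f(4) g(1) by simp
  then have "\<bar>1 - c U\<bar> < 1/2"
    using g(2)[OF U(1), of \<one>] by simp
  then have cU: "1/2 < c U"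
    by linarith
  have "x \<otimes> g \<in> U" if "x \<in> E" for x
  proof (rule ccontr)
    assume "x \<otimes> g \<notin> U"
    then have "f U (x \<otimes> g) = 0"
      using f(3) that E(2) g(1) by blast
    then show False
      using g(2)[OF U(1), of x] that cU by simp
  qed
  then show ?thesis
    using g(1) U(1) by (auto simp: r_coset_def)
qed

end

section \<open>Pulling coverings back along an orbit map\<close>

context continuous_action
begin

lemma continuous_map_act:
  assumes g: "g \<in> carrier G"
  shows "continuous_map X X (\<phi> g)"
proof -
  have "continuous_map X (prod_topology T X) (\<lambda>x. (g, x))"
    using g by (simp add: continuous_map_pairedI topspace_eq_carrier)
  from continuous_map_compose[OF this continuous_act] show ?thesis
    by (simp add: o_def)
qed

text \<open>Joint continuity provides, around each point, a neighbourhood that some neighbourhood of \<open>\<one>\<close>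
  moves within a single member of the covering; compactness leaves finitely many of the latter to
  intersect.\<close>

lemma Lebesgue_neighbourhood:
  assumes X: "compact_space X" and open_\<W>: "\<And>W. W \<in> \<W> \<Longrightarrow> openin X W"
    and cover: "topspace X \<subseteq> \<Union>\<W>"
  obtains V where "openin T V" "\<one> \<in> V"
    "\<And>x. x \<in> topspace X \<Longrightarrow> \<exists>W\<in>\<W>. \<forall>v\<in>V. \<phi> v x \<in> W"
proof -
  have "\<exists>V N. openin T V \<and> \<one> \<in> V \<and> openin X N \<and> x \<in> N \<and> (\<exists>W\<in>\<W>. \<forall>v\<in>V. \<forall>y\<in>N. \<phi> v y \<in> W)"
    if x: "x \<in> topspace X" for x
  proof -
    obtain W where W: "W \<in> \<W>" "x \<in> W"
      using x cover by blast
    let ?S = "{p \<in> topspace (prod_topology T X). (\<lambda>(g, x). \<phi> g x) p \<in> W}"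
    have "openin (prod_topology T X) ?S"
      by (rule openin_continuous_map_preimage[OF continuous_act open_\<W>[OF W(1)]])
    moreover have "(\<one>, x) \<in> ?S"
      using x W(2) fun_cong[OF id_eq_one, of x] by (simp add: topspace_eq_carrier)
    ultimately obtain V N where VN: "openin T V" "openin X N" "\<one> \<in> V" "x \<in> N" "V \<times> N \<subseteq> ?S"
      unfolding openin_prod_topology_alt by meson
    have "\<phi> v y \<in> W" if "v \<in> V" "y \<in> N" for v y
    proof -
      have "(v, y) \<in> ?S" using that VN(5) by blast
      then show ?thesis by simp
    qed
    then show ?thesis
      using W(1) VN by blast
  qed
  then obtain V N where VN: "\<And>x. x \<in> topspace X \<Longrightarrow> openin T (V x) \<and> \<one> \<in> V x \<and> openin X (N x) \<and>
      x \<in> N x \<and> (\<exists>W\<in>\<W>. \<forall>v\<in>V x. \<forall>y\<in>N x. \<phi> v y \<in> W)"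
    by metis
  have "\<exists>\<F>. finite \<F> \<and> \<F> \<subseteq> N ` topspace X \<and> topspace X \<subseteq> \<Union>\<F>"
    using X[unfolded compact_space_alt, rule_format, of "N ` topspace X"] VN by blast
  then obtain K where K: "finite K" "K \<subseteq> topspace X" "topspace X \<subseteq> \<Union>(N ` K)"
    by (metis finite_subset_image)
  show thesis
  proof
    show "openin T (topspace T \<inter> \<Inter>(V ` K))"
      using K VN by (intro openin_Int_Inter) auto
    show "\<one> \<in> topspace T \<inter> \<Inter>(V ` K)"
      using K VN by (auto simp: topspace_eq_carrier)
    fix x assume "x \<in> topspace X"
    then obtain k where k: "k \<in> K" "x \<in> N k"
      using K(3) by blast
    then obtain W where "W \<in> \<W>" "\<forall>v\<in>V k. \<forall>y\<in>N k. \<phi> v y \<in> W"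
      using VN K(2) by blast
    then show "\<exists>W\<in>\<W>. \<forall>v\<in>topspace T \<inter> \<Inter>(V ` K). \<phi> v x \<in> W"
      using k by blast
  qed
qed

lemma right_uniform_covering_orbit_map:
  assumes X: "compact_space X" and open_\<W>: "\<And>W. W \<in> \<W> \<Longrightarrow> openin X W"
    and cover: "topspace X \<subseteq> \<Union>\<W>" and x: "x \<in> topspace X"
  shows "right_uniform_covering G T ((\<lambda>W. {g \<in> carrier G. \<phi> g x \<in> W}) ` \<W>)"
proof -
  obtain V where V: "openin T V" "\<one> \<in> V"
    "\<And>x. x \<in> topspace X \<Longrightarrow> \<exists>W\<in>\<W>. \<forall>v\<in>V. \<phi> v x \<in> W"
    using Lebesgue_neighbourhood[OF X open_\<W> cover] by blast
  have VG: "V \<subseteq> carrier G"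
    using openin_subset[OF V(1)] by (simp add: topspace_eq_carrier)
  have "\<exists>W\<in>\<W>. V #> g \<subseteq> {g \<in> carrier G. \<phi> g x \<in> W}" if g: "g \<in> carrier G" for g
  proof -
    have "\<phi> g x \<in> topspace X"
      using element_image[OF g x] by simp
    then obtain W where W: "W \<in> \<W>" "\<And>v. v \<in> V \<Longrightarrow> \<phi> v (\<phi> g x) \<in> W"
      using V(3) by blast
    then have "V #> g \<subseteq> {g \<in> carrier G. \<phi> g x \<in> W}"
      using VG g x by (auto simp: r_coset_def composition_rule)
    then show ?thesis using W(1) by blast
  qed
  then show ?thesis
    unfolding right_uniform_covering_def using V VG by (auto intro!: exI[of _ V])
qed

text \<open>In a Hausdorff space a point that \<open>g\<close> moves has a neighbourhood that \<open>g\<close> moves off itself.\<close>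

lemma moved_covering:
  assumes X: "compact_space X" "Hausdorff_space X"
    and nofix: "\<And>x. x \<in> topspace X \<Longrightarrow> \<exists>g\<in>carrier G. \<phi> g x \<noteq> x"
  obtains \<W> e where "finite \<W>" "\<And>W. W \<in> \<W> \<Longrightarrow> openin X W" "topspace X \<subseteq> \<Union>\<W>"
    "\<And>W. W \<in> \<W> \<Longrightarrow> e W \<in> carrier G" "\<And>W x. W \<in> \<W> \<Longrightarrow> x \<in> W \<Longrightarrow> \<phi> (e W) x \<notin> W"
proof -
  let ?\<M> = "{W. openin X W \<and> (\<exists>g\<in>carrier G. \<forall>x\<in>W. \<phi> g x \<notin> W)}"
  have "topspace X \<subseteq> \<Union>?\<M>"
  proof
    fix x assume x: "x \<in> topspace X"
    then obtain g where g: "g \<in> carrier G" "\<phi> g x \<noteq> x"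
      using nofix by blast
    moreover have "\<phi> g x \<in> topspace X"
      using element_image[OF g(1) x] by simp
    ultimately obtain A B where AB: "openin X A" "openin X B" "\<phi> g x \<in> A" "x \<in> B" "disjnt A B"
      using X(2) x unfolding Hausdorff_space_def by meson
    let ?W = "B \<inter> {y \<in> topspace X. \<phi> g y \<in> A}"
    have "openin X ?W"
      by (intro openin_Int AB openin_continuous_map_preimage[OF continuous_map_act[OF g(1)]])
    moreover have "\<forall>y\<in>?W. \<phi> g y \<notin> ?W"
      using AB(5) by (auto simp: disjnt_def)
    ultimately have "?W \<in> ?\<M>"
      using g(1) by blast
    moreover have "x \<in> ?W"
      using x AB by blast
    ultimately show "x \<in> \<Union>?\<M>" by blast
  qed
  then obtain \<W> where \<W>: "finite \<W>" "\<W> \<subseteq> ?\<M>" "topspace X \<subseteq> \<Union>\<W>"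
    using X(1)[unfolded compact_space_alt, rule_format, of ?\<M>] by blast
  then have "\<forall>W\<in>\<W>. \<exists>g. g \<in> carrier G \<and> (\<forall>x\<in>W. \<phi> g x \<notin> W)"
    by blast
  from bchoice[OF this] obtain e where e: "\<And>W. W \<in> \<W> \<Longrightarrow> e W \<in> carrier G"
      "\<And>W x. W \<in> \<W> \<Longrightarrow> x \<in> W \<Longrightarrow> \<phi> (e W) x \<notin> W"
    by blast
  have "openin X W" if "W \<in> \<W>" for W
    using \<W>(2) that by blast
  then show thesis
    using that[OF \<W>(1) _ \<W>(3) e] by blast
qed

lemma fixed_point_of_translate_in_covering:
  assumes X: "compact_space X" "Hausdorff_space X" "topspace X \<noteq> {}"
    and small: "\<And>E \<U>. \<lbrakk>finite E; E \<subseteq> carrier G; finite \<U>; right_uniform_covering G T \<U>\<rbrakk> \<Longrightarrow>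
      \<exists>g\<in>carrier G. \<exists>U\<in>\<U>. E #> g \<subseteq> U"
  shows "\<exists>x\<in>topspace X. \<forall>g\<in>carrier G. \<phi> g x = x"
proof (rule ccontr)
  assume "\<not> ?thesis"
  then obtain \<W> e where \<W>: "finite \<W>" "\<And>W. W \<in> \<W> \<Longrightarrow> openin X W" "topspace X \<subseteq> \<Union>\<W>"
    and e: "\<And>W. W \<in> \<W> \<Longrightarrow> e W \<in> carrier G" "\<And>W x. W \<in> \<W> \<Longrightarrow> x \<in> W \<Longrightarrow> \<phi> (e W) x \<notin> W"
    using moved_covering[OF X(1,2)] by metis
  obtain x where x: "x \<in> topspace X"
    using X(3) by blast
  let ?\<U> = "(\<lambda>W. {g \<in> carrier G. \<phi> g x \<in> W}) ` \<W>"
  have "right_uniform_covering G T ?\<U>"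
    by (rule right_uniform_covering_orbit_map[OF X(1) \<W>(2,3) x])
  then obtain g W where g: "g \<in> carrier G" and W: "W \<in> \<W>"
    and sub: "insert \<one> (e ` \<W>) #> g \<subseteq> {g \<in> carrier G. \<phi> g x \<in> W}"
    using small[of "insert \<one> (e ` \<W>)" ?\<U>] \<W>(1) e(1) by (auto simp: image_subset_iff)
  \<comment> \<open>The same \<open>W\<close> serves as the member that contains the translate and as the index of \<open>e W\<close>.\<close>
  have "\<phi> (\<one> \<otimes> g) x \<in> W" "\<phi> (e W \<otimes> g) x \<in> W"
    using sub W by (auto simp: r_coset_def)
  then have "\<phi> g x \<in> W" "\<phi> (e W) (\<phi> g x) \<in> W"
    using g W e(1) x by (simp_all add: composition_rule)
  then show False
    using e(2) W by blast
qed

end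

section \<open>The characterization of extreme amenability\<close>

theorem corollary8p6:
  fixes G :: "('a, 'b) monoid_scheme" and T :: "'a topology"
  assumes "topological_group G T"
  shows "extremely_amenable G T \<longleftrightarrow>
    (\<forall>E \<U>. finite E \<and> E \<subseteq> carrier G \<and> finite \<U> \<and> right_uniform_covering G T \<U> \<longrightarrow>
       (\<exists>g\<in>carrier G. \<exists>U\<in>\<U>. E #>\<^bsub>G\<^esub> g \<subseteq> U))"
proof
  assume "extremely_amenable G T"
  then show "\<forall>E \<U>. finite E \<and> E \<subseteq> carrier G \<and> finite \<U> \<and> right_uniform_covering G T \<U> \<longrightarrow>
       (\<exists>g\<in>carrier G. \<exists>U\<in>\<U>. E #>\<^bsub>G\<^esub> g \<subseteq> U)"
    using topological_group.extremely_amenable_imp_translate_in_covering[OF assms] by blast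
next
  assume "\<forall>E \<U>. finite E \<and> E \<subseteq> carrier G \<and> finite \<U> \<and> right_uniform_covering G T \<U> \<longrightarrow>
       (\<exists>g\<in>carrier G. \<exists>U\<in>\<U>. E #>\<^bsub>G\<^esub> g \<subseteq> U)"
  then show "extremely_amenable G T"
    unfolding extremely_amenable_def
    by (intro allI impI continuous_action.fixed_point_of_translate_in_covering[where T = T]) auto
qed

end
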